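(* Let $u$ be an upper semi-continuous function on an open set $X\subset\mathbb C^n$. Then the following are equivalent: $u$ is dually Lagrangian plurisubharmonic on $X$; $u$ is "sub" the traceless hermitian degree-2 polynomials on $X$; $u$ is locally "sub" the traceless hermitian degree-2 polynomials on $X$.
   Context: Upper semi-continuous functions take values in $[-\infty,\infty)$. A real $n$-plane $W\subset\mathbb C^n=(\mathbb R^{2n},J,\langle\cdot,\cdot\rangle)$ is Lagrangian if $JW=W^\perp$; $\mathrm{LAG}$ is the set of these. $\widetilde{\mathcal P}(\mathrm{LAG})=\{A\in\mathrm{Sym}^2_{\mathbb R}(\mathbb C^n):\exists\,W\in\mathrm{LAG}\text{ with }\mathrm{tr}(A|_W)\ge0\}$, where $\mathrm{Sym}^2_{\mathbb R}(\mathbb C^n)$ is the space of real symmetric bilinear forms on $\mathbb R^{2n}$. $u$ is dually Lagrangian plurisubharmonic on $X$ if for each $x\in X$ and each smooth $\varphi$ defined near $x$ with $u\le\varphi$ near $x$ and equality at $x$, one has $D^2_x\varphi\in\widetilde{\mathcal P}(\mathrm{LAG})$. A traceless hermitian degree-2 polynomial is a real-valued function of the form $h(z)=c+\sum_k(b_kz_k+\overline b_k\overline z_k)+\frac12\sum_{i,j}a_{ij}z_i\overline z_j$ with $c\in\mathbb R$, $b\in\mathbb C^n$, $(a_{ij})$ a hermitian matrix of trace $0$. $u$ is "sub" the traceless hermitian degree-2 polynomials on $X$ if for all domains $\Omega\subset\subset X$ and all traceless hermitian degree-2 polynomials $h$: $u\le h$ on $\partial\Omega$ implies $u\le h$ on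 $\overline\Omega$. It is locally "sub" if each point of $X$ has an open neighborhood on which $u$ is "sub" these polynomials. *)

theory Defs
  imports "HOL-Analysis.Analysis"
begin

text \<open>
  The space of complex \<open>n\<close>-vectors is \<^typ>\<open>complex^'n\<close>, viewed as a real Euclidean space of
  dimension \<open>2n\<close>: the inner product \<open>v \<bullet> w\<close> is the real part of the standard hermitian product,
  and \<open>span\<close>, \<open>subspace\<close>, \<open>dim\<close> and \<open>bilinear\<close> are those of the real vector space.
\<close>

definition cJ :: "complex^'n \<Rightarrow> complex^'n" where
  "cJ z = \<i> *s z"

definition LAG :: "(complex^'n) set set" where
  "LAG = {W. subspace W \<and> dim W = CARD('n) \<and> cJ ` W = orthogonal_comp W}"

definition Sym2 :: "('a::real_vector \<Rightarrow> 'a \<Rightarrow> real) set" where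
  "Sym2 = {A. bilinear A \<and> (\<forall>v w. A v w = A w v)}"

definition orthonormal_basis_of :: "'a::euclidean_space set \<Rightarrow> 'a set \<Rightarrow> bool" where
  "orthonormal_basis_of W B \<longleftrightarrow>
     pairwise orthogonal B \<and> (\<forall>b\<in>B. norm b = 1) \<and> span B = W"

text \<open>The choice of basis is immaterial: see \<open>trace_on_eq\<close> below.\<close>

definition trace_on :: "'a::euclidean_space set \<Rightarrow> ('a \<Rightarrow> 'a \<Rightarrow> real) \<Rightarrow> real" where
  "trace_on W A = (\<Sum>b\<in>(SOME B. orthonormal_basis_of W B). A b b)"

lemma orthonormal_basis_of_finite:
  fixes W :: "'a::euclidean_space set"
  assumes "orthonormal_basis_of W B"
  shows "finite B"
  using assms pairwise_orthogonal_imp_finite unfolding orthonormal_basis_of_def by blast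

lemma orthonormal_basis_of_exists:
  fixes W :: "'a::euclidean_space set"
  assumes "subspace W"
  shows "\<exists>B. orthonormal_basis_of W B"
  using orthonormal_basis_subspace[OF assms] unfolding orthonormal_basis_of_def by metis

lemma trace_orthonormal_basis_independent:
  fixes W :: "'a::euclidean_space set" and A :: "'a \<Rightarrow> 'a \<Rightarrow> real"
  assumes A: "bilinear A" and B: "orthonormal_basis_of W B" and C: "orthonormal_basis_of W C"
  shows "(\<Sum>b\<in>B. A b b) = (\<Sum>c\<in>C. A c c)"
proof -
  have linl: "linear (\<lambda>x. A x y)" and linr: "linear (A x)" for x y
    using A by (auto simp: bilinear_def)
  have fin: "finite B" "finite C"
    using B C orthonormal_basis_of_finite by blast+
  have expC: "(\<Sum>c\<in>C. (b \<bullet> c) *\<^sub>R c) = b" if "b \<in> B" for b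
  proof (rule orthonormal_basis_expand)
    show "b \<in> span C"
      using that B C span_base unfolding orthonormal_basis_of_def by metis
  qed (use C fin in \<open>auto simp: orthonormal_basis_of_def\<close>)
  have expB: "(\<Sum>b\<in>B. (c \<bullet> b) *\<^sub>R b) = c" if "c \<in> C" for c
  proof (rule orthonormal_basis_expand)
    show "c \<in> span B"
      using that B C span_base unfolding orthonormal_basis_of_def by metis
  qed (use B fin in \<open>auto simp: orthonormal_basis_of_def\<close>)
  have "(\<Sum>b\<in>B. A b b) = (\<Sum>b\<in>B. A (\<Sum>c\<in>C. (b \<bullet> c) *\<^sub>R c) b)"
    by (simp add: expC)
  also have "\<dots> = (\<Sum>b\<in>B. \<Sum>c\<in>C. (b \<bullet> c) * A c b)"
    by (simp add: linear_sum[OF linl] linear_cmul[OF linl])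
  also have "\<dots> = (\<Sum>c\<in>C. \<Sum>b\<in>B. (c \<bullet> b) * A c b)"
    by (subst sum.swap) (simp add: inner_commute)
  also have "\<dots> = (\<Sum>c\<in>C. A c (\<Sum>b\<in>B. (c \<bullet> b) *\<^sub>R b))"
    by (simp add: linear_sum[OF linr] linear_cmul[OF linr])
  also have "\<dots> = (\<Sum>c\<in>C. A c c)"
    by (simp add: expB)
  finally show ?thesis .
qed

lemma trace_on_eq:
  fixes W :: "'a::euclidean_space set"
  assumes "bilinear A" and "orthonormal_basis_of W B"
  shows "trace_on W A = (\<Sum>b\<in>B. A b b)"
  unfolding trace_on_def
  using trace_orthonormal_basis_independent[OF assms(1) someI[of "orthonormal_basis_of W"]] assms(2)
  by blast

definition P_dual_LAG :: "(complex^'n \<Rightarrow> complex^'n \<Rightarrow> real) set" where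
  "P_dual_LAG = {A \<in> Sym2. \<exists>W\<in>LAG. 0 \<le> trace_on W A}"

text \<open>
  \<open>C_k_on k U f\<close>, meaningful for open \<open>U\<close>: the iterated derivatives of \<open>f\<close> in constant
  directions, up to order \<open>k\<close>, exist (as Frechet derivatives) and are continuous on \<open>U\<close>.
\<close>

primrec C_k_on :: "nat \<Rightarrow> 'a::real_normed_vector set \<Rightarrow> ('a \<Rightarrow> real) \<Rightarrow> bool" where
  "C_k_on 0 U f \<longleftrightarrow> continuous_on U f"
| "C_k_on (Suc k) U f \<longleftrightarrow>
     (\<forall>x\<in>U. f differentiable (at x)) \<and>
     (\<forall>v. C_k_on k U (\<lambda>x. frechet_derivative f (at x) v))"

definition smooth_on :: "'a::real_normed_vector set \<Rightarrow> ('a \<Rightarrow> real) \<Rightarrow> bool" where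
  "smooth_on U f \<longleftrightarrow> (\<forall>k. C_k_on k U f)"

definition hessian_at :: "('a::real_normed_vector \<Rightarrow> real) \<Rightarrow> 'a \<Rightarrow> 'a \<Rightarrow> 'a \<Rightarrow> real" where
  "hessian_at f x v w =
     frechet_derivative (\<lambda>y. frechet_derivative f (at y) v) (at x) w"

text \<open>Upper semi-continuous functions may take the value \<open>-\<infinity>\<close> but not \<open>\<infinity>\<close>.\<close>

definition usc_on :: "'a::topological_space set \<Rightarrow> ('a \<Rightarrow> ereal) \<Rightarrow> bool" where
  "usc_on X u \<longleftrightarrow>
     (\<forall>x\<in>X. u x < \<infinity> \<and> (\<forall>t>u x. \<forall>\<^sub>F y in at x within X. u y < t))"

definition dually_Lagrangian_psh :: "(complex^'n) set \<Rightarrow> (complex^'n \<Rightarrow> ereal) \<Rightarrow> bool" where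
  "dually_Lagrangian_psh X u \<longleftrightarrow>
     (\<forall>x\<in>X. \<forall>U \<phi>. open U \<and> x \<in> U \<and> U \<subseteq> X \<and> smooth_on U \<phi> \<and>
        (\<forall>y\<in>U. u y \<le> ereal (\<phi> y)) \<and> u x = ereal (\<phi> x)
        \<longrightarrow> hessian_at \<phi> x \<in> P_dual_LAG)"

definition traceless_hermitian_poly :: "(complex^'n \<Rightarrow> real) \<Rightarrow> bool" where
  "traceless_hermitian_poly h \<longleftrightarrow>
     (\<exists>(c::real) (b::complex^'n) (a::complex^'n^'n).
        (\<forall>i j. a $ j $ i = cnj (a $ i $ j)) \<and> trace a = 0 \<and>
        (\<forall>z. complex_of_real (h z) =
           complex_of_real c
           + (\<Sum>k\<in>UNIV. b $ k * z $ k + cnj (b $ k) * cnj (z $ k))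
           + 1/2 * (\<Sum>i\<in>UNIV. \<Sum>j\<in>UNIV. a $ i $ j * z $ i * cnj (z $ j))))"

definition sub_traceless_hermitian :: "(complex^'n) set \<Rightarrow> (complex^'n \<Rightarrow> ereal) \<Rightarrow> bool" where
  "sub_traceless_hermitian X u \<longleftrightarrow>
     (\<forall>\<Omega> h. open \<Omega> \<and> connected \<Omega> \<and> \<Omega> \<noteq> {} \<and> compact (closure \<Omega>) \<and> closure \<Omega> \<subseteq> X \<and>
        traceless_hermitian_poly h \<and> (\<forall>z\<in>frontier \<Omega>. u z \<le> ereal (h z))
        \<longrightarrow> (\<forall>z\<in>closure \<Omega>. u z \<le> ereal (h z)))"

definition locally_sub_traceless_hermitian ::
  "(complex^'n) set \<Rightarrow> (complex^'n \<Rightarrow> ereal) \<Rightarrow> bool" where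
  "locally_sub_traceless_hermitian X u \<longleftrightarrow>
     (\<forall>x\<in>X. \<exists>U. open U \<and> x \<in> U \<and> U \<subseteq> X \<and> sub_traceless_hermitian U u)"

end

theory Submission
  imports Defs
begin

text \<open>
  If \<open>u\<close> is dually Lagrangian plurisubharmonic but exceeds \<open>h\<close> somewhere on \<open>\<Omega>\<close> and not on its boundary,
  then \<open>u - h + \<epsilon> |z|\<^sup>2\<close> has an interior maximum for small \<open>\<epsilon>\<close>, so a translate of \<open>h - \<epsilon> |z|\<^sup>2\<close> touches
  \<open>u\<close> from above. The trace of a \<open>J\<close>-invariant form on a Lagrangian plane is half its full trace, hence
  the Hessian of \<open>h - \<epsilon> |z|\<^sup>2\<close> has trace \<open>-2 n \<epsilon> < 0\<close> on every Lagrangian plane, a contradiction.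

  Conversely, let a test function touch \<open>u\<close> from above with Hessian \<open>A\<close> outside the dual cone. The
  \<open>J\<close>-anti-invariant part of \<open>A\<close> is diagonal, with eigenvalues \<open>\<lambda>\<^sub>k \<ge> 0\<close> and \<open>-\<lambda>\<^sub>k\<close>, in some orthonormal
  basis \<open>e\<^sub>k, J e\<^sub>k\<close>. Replacing this part by the \<open>J\<close>-invariant form with eigenvalue \<open>\<lambda>\<^sub>k + t\<close> on the
  complex line of \<open>e\<^sub>k\<close> gives a form \<open>B\<close> with \<open>B - A \<ge> t |v|\<^sup>2\<close>, and \<open>B\<close> is traceless for
  \<open>t = - tr (A|W) / n\<close>, where the Lagrangian plane \<open>W\<close> is spanned by the \<open>e\<^sub>k\<close>; here \<open>t > 0\<close>. The
  quadratic polynomial with Hessian \<open>B\<close>, lowered slightly, violates the \<open>sub\<close> property on a small ball.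
\<close>

subsection \<open>Unitary families and Lagrangian planes\<close>

lemma linear_cJ: "linear cJ"
  by (rule linearI) (simp_all add: cJ_def vec_eq_iff algebra_simps)

lemma cJ_cJ [simp]: "cJ (cJ z) = - z"
  by (simp add: cJ_def vec_eq_iff)

lemma inner_cJ_cJ [simp]: "cJ v \<bullet> cJ w = v \<bullet> w"
  by (simp add: cJ_def inner_vec_def inner_complex_def algebra_simps)

lemma inner_cJ_right: "v \<bullet> cJ w = - (cJ v \<bullet> w)"
  using inner_cJ_cJ[of v "cJ w"] by simp

lemma inner_cJ_self [simp]: "cJ v \<bullet> v = 0"
  using inner_cJ_right[of v v] by (simp add: inner_commute)

lemma norm_cJ [simp]: "norm (cJ v) = norm v"
  by (simp add: norm_eq_sqrt_inner)

lemma cJ_axis_1 [simp]: "cJ (axis i 1) = axis i \<i>"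
  by (simp add: cJ_def vec_eq_iff axis_def)

lemma inj_cJ: "inj cJ"
  by (metis cJ_cJ injI neg_equal_iff_equal)

text \<open>Orthonormality for the hermitian product: \<open>e \<bullet> f\<close> is its real part
  and \<open>cJ e \<bullet> f\<close> its imaginary part up to sign.\<close>

definition unitary_family :: "(complex^'n) set \<Rightarrow> bool" where
  "unitary_family S \<longleftrightarrow> (\<forall>e\<in>S. \<forall>f\<in>S. e \<bullet> f = (if e = f then 1 else 0) \<and> cJ e \<bullet> f = 0)"

lemma unitary_familyD:
  assumes "unitary_family S" "e \<in> S" "f \<in> S"
  shows "e \<bullet> f = (if e = f then 1 else 0)" "cJ e \<bullet> f = 0" "e \<bullet> cJ f = 0"
  using assms inner_cJ_right[of e f] unfolding unitary_family_def by auto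

lemma unitary_family_disjoint:
  assumes "unitary_family S"
  shows "S \<inter> cJ ` S = {}"
  using unitary_familyD[OF assms] by fastforce

lemma unitary_family_orthonormal:
  assumes "unitary_family S"
  shows "orthonormal_basis_of (span S) S"
    and "orthonormal_basis_of (span (S \<union> cJ ` S)) (S \<union> cJ ` S)"
  using unitary_familyD[OF assms]
  by (auto simp: orthonormal_basis_of_def pairwise_def orthogonal_def norm_eq_1 split: if_splits)

lemma unitary_family_finite: "unitary_family S \<Longrightarrow> finite S"
  using orthonormal_basis_of_finite unitary_family_orthonormal(1) by blast

lemma orthonormal_basis_of_card:
  assumes "orthonormal_basis_of W B"
  shows "card B = dim W"
proof -
  have "0 \<notin> B"
    using assms unfolding orthonormal_basis_of_def by force
  then have "independent B"
    using assms pairwise_orthogonal_independent unfolding orthonormal_basis_of_def by blast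
  then show ?thesis
    using assms dim_span_eq_card_independent[of B] unfolding orthonormal_basis_of_def by simp
qed

lemma unitary_family_card:
  assumes "unitary_family S"
  shows "card (S \<union> cJ ` S) = 2 * card S"
  using unitary_family_finite[OF assms] unitary_family_disjoint[OF assms]
  by (simp add: card_Un_disjoint card_image[OF inj_on_subset[OF inj_cJ]])

lemma DIM_complex_vec: "DIM(complex^'n) = 2 * CARD('n)"
  by simp

lemma unitary_family_span:
  fixes S :: "(complex^'n) set"
  assumes S: "unitary_family S" and card: "card S = CARD('n)"
  shows "orthonormal_basis_of UNIV (S \<union> cJ ` S)"
proof -
  have "dim (span (S \<union> cJ ` S)) = DIM(complex^'n)"
    using orthonormal_basis_of_card[OF unitary_family_orthonormal(2)[OF S]]
      unitary_family_card[OF S] card DIM_complex_vec by metis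
  then have "span (S \<union> cJ ` S) = UNIV"
    by (metis dim_eq_full dim_span)
  then show ?thesis
    using unitary_family_orthonormal(2)[OF S] by simp
qed

lemma sum_unitary_family:
  assumes "unitary_family S"
  shows "(\<Sum>b\<in>S \<union> cJ ` S. f b) = (\<Sum>e\<in>S. f e + f (cJ e))"
  using unitary_family_finite[OF assms] unitary_family_disjoint[OF assms]
  by (simp add: sum.union_disjoint sum.distrib sum.reindex[OF inj_on_subset[OF inj_cJ]])

lemma unitary_family_expand:
  fixes S :: "(complex^'n) set"
  assumes S: "unitary_family S" and card: "card S = CARD('n)"
  shows "(\<Sum>e\<in>S. (v \<bullet> e) *\<^sub>R e + (v \<bullet> cJ e) *\<^sub>R cJ e) = v"
proof -
  have "(\<Sum>b\<in>S \<union> cJ ` S. (v \<bullet> b) *\<^sub>R b) = v"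
    using unitary_family_span[OF S card] unitary_family_finite[OF S]
    by (intro orthonormal_basis_expand) (auto simp: orthonormal_basis_of_def)
  then show ?thesis
    by (simp add: sum_unitary_family[OF S])
qed

lemma unitary_family_axis: "unitary_family (range (\<lambda>i. axis i 1 :: complex^'n))"
  by (auto simp: unitary_family_def inner_axis_axis axis_eq_axis)

lemma inj_axis_1: "inj (\<lambda>i. axis i 1 :: complex^'n)"
  by (simp add: inj_def axis_eq_axis)

section \<open>Traces of J-invariant forms, and Lagrangian planes as spans of unitary
  families\<close>

definition J_invariant :: "(complex^'n \<Rightarrow> complex^'n \<Rightarrow> real) \<Rightarrow> bool" where
  "J_invariant B \<longleftrightarrow> (\<forall>v w. B (cJ v) (cJ w) = B v w)"

lemma J_invariant_trace:
  fixes S :: "(complex^'n) set"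
  assumes B: "bilinear B" "J_invariant B" and S: "unitary_family S" "card S = CARD('n)"
  shows "(\<Sum>e\<in>S. B e e) = (\<Sum>i\<in>UNIV. B (axis i 1) (axis i 1))"
proof -
  let ?E = "range (\<lambda>i. axis i 1 :: complex^'n)"
  have *: "(\<Sum>b\<in>T \<union> cJ ` T. B b b) = 2 * (\<Sum>e\<in>T. B e e)" if "unitary_family T" for T
    using B by (simp add: sum_unitary_family[OF that] J_invariant_def sum_distrib_left)
  have "card ?E = CARD('n)"
    by (simp add: card_image inj_axis_1)
  then have "(\<Sum>e\<in>S. B e e) = (\<Sum>e\<in>?E. B e e)"
    using trace_orthonormal_basis_independent[OF B(1) unitary_family_span[OF S]
        unitary_family_span[OF unitary_family_axis]] *[OF S(1)] *[OF unitary_family_axis]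
    by simp
  then show ?thesis
    by (simp add: sum.reindex[OF inj_axis_1])
qed

text \<open>The unitary relations extend bilinearly to the span, so J maps it into its orthogonal
  complement. Conversely, a vector orthogonal to \<open>S\<close> keeps only its \<open>cJ e\<close>
  components in the unitary expansion, hence is J of a vector of the span.\<close>

lemma span_unitary_family_LAG:
  fixes S :: "(complex^'n) set"
  assumes S: "unitary_family S" and card: "card S = CARD('n)"
  shows "span S \<in> LAG"
proof -
  have orth: "e \<bullet> cJ x = 0" if "e \<in> S" "x \<in> span S" for e x
    using that(2)
  proof (induction rule: span_induct_alt)
    case base
    then show ?case by (simp add: linear_0 linear_cJ)
  next
    case (step c x y)
    then show ?case
      using unitary_familyD[OF S that(1)]
      by (simp add: linear_add[OF linear_cJ] linear_cmul[OF linear_cJ] inner_add_right)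
  qed
  have orth': "y \<bullet> cJ x = 0" if "y \<in> span S" "x \<in> span S" for y x
    using that(1)
    by (induction rule: span_induct_alt) (simp_all add: inner_add_left orth that)
  have "cJ ` span S = orthogonal_comp (span S)"
  proof (intro subset_antisym subsetI)
    fix z assume "z \<in> cJ ` span S"
    then show "z \<in> orthogonal_comp (span S)"
      using orth' by (auto simp: orthogonal_comp_def orthogonal_def)
  next
    fix z assume "z \<in> orthogonal_comp (span S)"
    then have "z \<bullet> e = 0" if "e \<in> S" for e
      using that span_base by (force simp: orthogonal_comp_def orthogonal_def inner_commute)
    then have "z = (\<Sum>e\<in>S. (z \<bullet> cJ e) *\<^sub>R cJ e)"
      using unitary_family_expand[OF S card, of z] by simp
    also have "\<dots> = cJ (\<Sum>e\<in>S. (z \<bullet> cJ e) *\<^sub>R e)"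
      by (simp add: linear_sum[OF linear_cJ] linear_cmul[OF linear_cJ])
    finally show "z \<in> cJ ` span S"
      by (metis (no_types, lifting) imageI span_base span_scale span_sum)
  qed
  moreover have "dim (span S) = CARD('n)"
    using orthonormal_basis_of_card[OF unitary_family_orthonormal(1)[OF S]] card by simp
  ultimately show ?thesis
    by (simp add: LAG_def)
qed

text \<open>The converse of \<open>span_unitary_family_LAG\<close>: for \<open>e\<close> in a
  Lagrangian plane, \<open>cJ e\<close> is orthogonal to that plane.\<close>

lemma LAG_basis_unitary:
  fixes W :: "(complex^'n) set"
  assumes W: "W \<in> LAG" and S: "orthonormal_basis_of W S"
  shows "unitary_family S" "card S = CARD('n)"
proof -
  have "cJ e \<bullet> f = 0" if "e \<in> S" "f \<in> S" for e f
  proof -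
    have "e \<in> W" "f \<in> W"
      using S that span_base unfolding orthonormal_basis_of_def by blast+
    then have "cJ e \<in> orthogonal_comp W" "f \<in> W"
      using W unfolding LAG_def by auto
    then show ?thesis
      by (auto simp: orthogonal_comp_def orthogonal_def inner_commute)
  qed
  then show "unitary_family S"
    using S by (auto simp: unitary_family_def orthonormal_basis_of_def pairwise_def
        orthogonal_def norm_eq_1)
  show "card S = CARD('n)"
    using orthonormal_basis_of_card[OF S] W by (simp add: LAG_def)
qed

text \<open>Each step of the induction adds a maximiser of \<open>A v v\<close> on the unit sphere of the orthogonal
  complement of the family and its image under \<open>J\<close>.\<close>

lemma J_anti_invariant_diagonalizable:
  fixes A :: "complex^'n \<Rightarrow> complex^'n \<Rightarrow> real"
  assumes bil: "bilinear A" and sym: "\<And>v w. A v w = A w v"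
    and anti: "\<And>v w. A (cJ v) (cJ w) = - A v w"
  obtains S where "unitary_family S" "card S = CARD('n)"
    "\<And>e w. e \<in> S \<Longrightarrow> e \<bullet> w = 0 \<Longrightarrow> A e w = 0" "\<And>e. e \<in> S \<Longrightarrow> 0 \<le> A e e"
proof -
  \<comment> \<open>Anti-invariance applied to \<open>v\<close> and \<open>cJ w\<close>, with J
    squared equal to -1.\<close>
  have AJ: "A (cJ v) w = A v (cJ w)" for v w
    using anti[of v "cJ w"] by (simp add: bilinear_rneg[OF bil])
  \<comment> \<open>The last clause says that \<open>e\<close> is an eigenvector of
    \<open>A\<close>, with eigenvalue \<open>A e e\<close>, without naming the associated
    operator.\<close>
  define good where "good S \<longleftrightarrow> unitary_family S \<and>
    (\<forall>e\<in>S. 0 \<le> A e e \<and> (\<forall>w. e \<bullet> w = 0 \<longrightarrow> A e w = 0))" for S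
  have "\<exists>S. good S \<and> card S = k" if "k \<le> CARD('n)" for k
    using that
  proof (induction k)
    case 0
    have "good {}" by (simp add: good_def unitary_family_def)
    then show ?case by (metis card.empty)
  next
    case (Suc k)
    then obtain S where S: "good S" "card S = k"
      by auto
    have u: "unitary_family S" and ge: "\<And>e. e \<in> S \<Longrightarrow> 0 \<le> A e e"
      and eig: "\<And>e w. e \<in> S \<Longrightarrow> e \<bullet> w = 0 \<Longrightarrow> A e w = 0"
      using S by (auto simp: good_def)
    have fin: "finite S" by (rule unitary_family_finite[OF u])
    define V where "V = orthogonal_comp (S \<union> cJ ` S)"
    have V_iff: "v \<in> V \<longleftrightarrow> (\<forall>e\<in>S. e \<bullet> v = 0 \<and> cJ e \<bullet> v = 0)" for v
      by (auto simp: V_def orthogonal_comp_def orthogonal_def)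
    have VJ: "cJ v \<in> V" if "v \<in> V" for v
      using that by (simp add: V_iff inner_cJ_right)
    have subV: "subspace V"
      unfolding V_def by (rule subspace_orthogonal_comp)
    \<comment> \<open>Only \<open>2 * k\<close> real dimensions are occupied so far and
      \<open>k < CARD('n)\<close>, so \<open>V\<close> contains a nonzero vector.\<close>
    have "span (S \<union> cJ ` S) \<noteq> UNIV"
    proof
      assume "span (S \<union> cJ ` S) = UNIV"
      then have "card (S \<union> cJ ` S) = DIM(complex^'n)"
        using orthonormal_basis_of_card[OF unitary_family_orthonormal(2)[OF u]] by simp
      then show False
        using unitary_family_card[OF u] S(2) Suc.prems by simp
    qed
    then obtain a where a: "a \<noteq> 0" "\<And>x. x \<in> span (S \<union> cJ ` S) \<Longrightarrow> a \<bullet> x = 0"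
      using span_not_univ_subset_hyperplane[of "S \<union> cJ ` S"] by blast
    have aV: "a \<in> V"
      using a(2) span_base[of _ "S \<union> cJ ` S"] by (auto simp: V_iff inner_commute[of a])
    let ?K = "V \<inter> sphere 0 1"
    have "compact ?K"
      by (simp add: closed_subspace subV closed_Int_compact)
    moreover have "a /\<^sub>R norm a \<in> ?K"
      using a(1) aV subV by (simp add: subspace_scale)
    then have "?K \<noteq> {}" by blast
    moreover have "continuous_on ?K (\<lambda>v. A v v)"
      using bilinear_continuous_on_compose[OF continuous_on_id continuous_on_id bil] .
    ultimately obtain e where e: "e \<in> V" "norm e = 1" and
      max: "\<And>v. v \<in> V \<Longrightarrow> norm v = 1 \<Longrightarrow> A v v \<le> A e e"
      using continuous_attains_sup[of ?K "\<lambda>v. A v v"] by (smt (verit) IntE IntI mem_sphere_0)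
    have max': "A v v \<le> A e e * (v \<bullet> v)" if "v \<in> V" for v
    proof (cases "v = 0")
      case True
      then show ?thesis by (simp add: bilinear_lzero[OF bil])
    next
      case False
      have "A (v /\<^sub>R norm v) (v /\<^sub>R norm v) \<le> A e e"
        using that False subV by (intro max) (simp_all add: subspace_scale)
      then show ?thesis
        using False by (simp add: bilinear_lmul[OF bil] bilinear_rmul[OF bil]
            dot_square_norm power2_eq_square field_simps)
    qed
    \<comment> \<open>First-order condition at the maximum: moving from \<open>e\<close> to
      \<open>e + t *\<^sub>R w\<close> changes \<open>A\<close> by a term linear in
      \<open>t\<close>, while \<open>max'\<close> only leaves room for a quadratic one.\<close>
    have eV: "A e w = 0" if w: "w \<in> V" "e \<bullet> w = 0" for w
    proof (rule ccontr)
      assume nz: "A e w \<noteq> 0"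
      define c where "c = A e e * (w \<bullet> w) - A w w"
      have *: "2 * t * A e w \<le> t\<^sup>2 * c" for t
      proof -
        have "A (e + t *\<^sub>R w) (e + t *\<^sub>R w) \<le> A e e * ((e + t *\<^sub>R w) \<bullet> (e + t *\<^sub>R w))"
          using e w subV by (intro max') (simp add: subspace_add subspace_scale)
        moreover have "e \<bullet> e = 1" using e by (simp add: norm_eq_1)
        ultimately show ?thesis
          using w(2) sym[of w e]
          by (simp add: c_def bilinear_ladd[OF bil] bilinear_radd[OF bil] bilinear_lmul[OF bil]
              bilinear_rmul[OF bil] inner_add inner_commute algebra_simps power2_eq_square)
      qed
      have "0 \<le> c"
        using max'[OF w(1)] by (simp add: c_def)
      \<comment> \<open>A small step in the direction of the sign of \<open>A e w\<close>, for which
        the linear term beats the quadratic one; \<open>c + 1\<close> keeps the denominator positive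
        when \<open>c = 0\<close>.\<close>
      define t where "t = A e w / (c + 1)"
      have tc: "t * (c + 1) = A e w"
        using \<open>0 \<le> c\<close> by (simp add: t_def)
      have "t \<noteq> 0" using nz tc by auto
      have "2 * t * (t * (c + 1)) \<le> t\<^sup>2 * c"
        using *[of t] tc by simp
      then have "t\<^sup>2 * (c + 2) \<le> 0"
        by (simp add: power2_eq_square algebra_simps)
      moreover have "t\<^sup>2 * (c + 2) > 0"
        using \<open>t \<noteq> 0\<close> \<open>0 \<le> c\<close> by simp
      ultimately show False by simp
    qed
    have orth: "e \<bullet> s = 0" "e \<bullet> cJ s = 0" "cJ e \<bullet> s = 0" "s \<bullet> e = 0" "cJ s \<bullet> e = 0"
      if "s \<in> S" for s
      using that e(1) VJ[OF e(1)] by (auto simp: V_iff inner_commute)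
    have e_eig: "A e w = 0" if w: "e \<bullet> w = 0" for w
    proof -
      define p where "p = (\<Sum>s\<in>S. (w \<bullet> s) *\<^sub>R s + (w \<bullet> cJ s) *\<^sub>R cJ s)"
      have delta: "(\<Sum>f\<in>S. g f * (s \<bullet> f)) = g s" if "s \<in> S" for s and g :: "_ \<Rightarrow> real"
      proof -
        have "(\<Sum>f\<in>S. g f * (s \<bullet> f)) = (\<Sum>f\<in>S. if f = s then g f else 0)"
          using unitary_familyD(1)[OF u that] by (intro sum.cong) auto
        then show ?thesis using fin that by simp
      qed
      have pr: "s \<bullet> p = w \<bullet> s" "cJ s \<bullet> p = w \<bullet> cJ s" if "s \<in> S" for s
        using unitary_familyD(2,3)[OF u that] delta[OF that]
        by (simp_all add: p_def inner_sum_right inner_add_right)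
      have "e \<bullet> p = 0"
        by (simp add: p_def inner_sum_right inner_add_right orth)
      then have "A e (w - p) = 0"
        using w pr by (intro eV) (auto simp: V_iff inner_diff_right inner_commute)
      moreover have "A p e = 0"
      proof -
        have "A e s = 0" "A e (cJ s) = 0" if "s \<in> S" for s
          using that eig[of s e] eig[of s "cJ e"] orth[OF that] sym[of e s] sym[of e "cJ s"]
          by (auto simp: AJ inner_commute)
        moreover have "linear (A e)"
          using bil by (simp add: bilinear_def)
        ultimately have "A e p = 0"
          by (simp add: p_def linear_sum linear_add linear_cmul)
        then show ?thesis
          using sym[of e p] by simp
      qed
      ultimately show ?thesis
        using sym[of e p] by (simp add: bilinear_rsub[OF bil])
    qed
    \<comment> \<open>\<open>cJ e\<close> competes in the same maximisation and has the opposite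
      value.\<close>
    have "0 \<le> A e e"
      using max[of "cJ e"] e VJ anti[of e e] by simp
    then have "good (insert e S)"
      using u e ge eig e_eig orth
      by (auto simp: good_def unitary_family_def norm_eq_1)
    moreover have "e \<notin> S"
      using orth(1)[of e] e by (auto simp: norm_eq_1)
    then have "card (insert e S) = Suc k" using S fin by simp
    ultimately show ?case by blast
  qed
  then show thesis
    using that good_def by blast
qed

subsection \<open>Traceless hermitian polynomials\<close>

lemma J_invariantD: "J_invariant B \<Longrightarrow> B (cJ v) (cJ w) = B v w"
  by (simp add: J_invariant_def)

lemma complex_vec_expand:
  fixes z :: "complex^'n"
  shows "z = (\<Sum>k\<in>UNIV. Re (z $ k) *\<^sub>R axis k 1 + Im (z $ k) *\<^sub>R cJ (axis k 1))"
proof -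
  have *: "(Re (z $ k) *\<^sub>R axis k 1 + Im (z $ k) *\<^sub>R cJ (axis k 1)) $ j = (if k = j then z $ k else 0)"
    for k j :: 'n
    unfolding cJ_axis_1 by (simp add: axis_def complex_eq_iff)
  show ?thesis
    unfolding vec_eq_iff sum_component * by simp
qed

lemma linear_complex_vec:
  fixes L :: "complex^'n \<Rightarrow> real"
  assumes "linear L"
  shows "L z = (\<Sum>k\<in>UNIV. Re (z $ k) * L (axis k 1) + Im (z $ k) * L (cJ (axis k 1)))"
proof -
  have "L z = L (\<Sum>k\<in>UNIV. Re (z $ k) *\<^sub>R axis k 1 + Im (z $ k) *\<^sub>R cJ (axis k 1))"
    by (rule arg_cong[OF complex_vec_expand])
  also have "\<dots> = (\<Sum>k\<in>UNIV. Re (z $ k) * L (axis k 1) + Im (z $ k) * L (cJ (axis k 1)))"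
    by (simp only: linear_sum[OF assms] linear_add[OF assms] linear_cmul[OF assms] real_scaleR_def)
  finally show ?thesis .
qed

text \<open>The hermitian matrix \<open>a\<close> of a symmetric \<open>J\<close>-invariant form \<open>B\<close> is read off the
  sesquilinear form \<open>B v w - \<i> B (J v) w\<close>, whose real part is \<open>B\<close>.\<close>

lemma traceless_hermitian_poly_iff:
  fixes h :: "complex^'n \<Rightarrow> real"
  shows "traceless_hermitian_poly h \<longleftrightarrow>
    (\<exists>c L B. linear L \<and> B \<in> Sym2 \<and> J_invariant B \<and>
       (\<Sum>i\<in>UNIV. B (axis i 1) (axis i 1)) = 0 \<and> (\<forall>z. h z = c + L z + B z z / 2))"
    (is "_ \<longleftrightarrow> ?rhs")
proof
  assume "traceless_hermitian_poly h"
  then obtain c :: real and b :: "complex^'n" and a :: "complex^'n^'n" where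
    herm: "\<And>i j. a $ j $ i = cnj (a $ i $ j)" and tr: "trace a = 0" and
    h: "\<And>z. complex_of_real (h z) = complex_of_real c
           + (\<Sum>k\<in>UNIV. b $ k * z $ k + cnj (b $ k) * cnj (z $ k))
           + 1/2 * (\<Sum>i\<in>UNIV. \<Sum>j\<in>UNIV. a $ i $ j * z $ i * cnj (z $ j))"
    unfolding traceless_hermitian_poly_def by blast
  define L where "L z = Re (\<Sum>k\<in>UNIV. b $ k * z $ k + cnj (b $ k) * cnj (z $ k))" for z
  define B where "B v w = Re (\<Sum>i\<in>UNIV. \<Sum>j\<in>UNIV. a $ i $ j * v $ i * cnj (w $ j))" for v w
  have "linear L"
    by (rule linearI) (simp_all add: L_def sum.distrib sum_distrib_left algebra_simps)
  moreover have bilB: "bilinear B"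
    unfolding bilinear_def
    by (intro conjI allI linearI)
      (simp_all only: B_def vector_add_component vector_scaleR_component ring_distribs sum.distrib
        complex_cnj_add complex_cnj_scaleR plus_complex.sel mult_scaleR_left mult_scaleR_right
        scaleR_sum_right[symmetric] scaleR_complex.sel real_scaleR_def)
  \<comment> \<open>Conjugation preserves the real part; by hermitian symmetry of \<open>a\<close>
    it exchanges the two arguments.\<close>
  have symB: "B v w = B w v" for v w
  proof -
    have "B v w = Re (cnj (\<Sum>i\<in>UNIV. \<Sum>j\<in>UNIV. a $ i $ j * v $ i * cnj (w $ j)))"
      by (simp only: B_def cnj.sel)
    also have "\<dots> = Re (\<Sum>i\<in>UNIV. \<Sum>j\<in>UNIV. a $ j $ i * w $ j * cnj (v $ i))"
      unfolding cnj_sum complex_cnj_mult complex_cnj_cnj herm[symmetric] by (simp only: ac_simps)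
    also have "\<dots> = B w v"
      by (subst sum.swap) (simp add: B_def)
    finally show ?thesis .
  qed
  moreover have "J_invariant B"
  proof -
    have "a $ i $ j * (\<i> * v $ i) * cnj (\<i> * w $ j) = a $ i $ j * v $ i * cnj (w $ j)" for v w i j
    proof -
      have "a $ i $ j * (\<i> * v $ i) * cnj (\<i> * w $ j) = (\<i> * cnj \<i>) * (a $ i $ j * v $ i * cnj (w $ j))"
        by (simp only: complex_cnj_mult ac_simps)
      then show ?thesis by simp
    qed
    then show ?thesis
      by (simp only: J_invariant_def B_def cJ_def vector_smult_component simp_thms)
  qed
  moreover have "(\<Sum>i\<in>UNIV. B (axis i 1) (axis i 1)) = Re (trace a)"
  proof -
    have "a $ i $ j * axis k 1 $ i * cnj (axis k 1 $ j) =
        (if j = k then if i = k then a $ i $ j else 0 else 0)" for i j k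
      by (simp add: axis_def)
    then have "B (axis k 1) (axis k 1) = Re (a $ k $ k)" for k
      by (simp only: B_def sum.delta finite UNIV_I if_True)
    then show ?thesis
      by (simp add: trace_def)
  qed
  moreover have "h z = c + L z + B z z / 2" for z
    using arg_cong[OF h[of z], of Re] by (simp add: L_def B_def del: Re_sum)
  moreover have "B \<in> Sym2"
    using bilB symB unfolding Sym2_def by blast
  ultimately show ?rhs
    using tr by (intro exI[of _ c] exI[of _ L] exI[of _ B]) auto
next
  assume ?rhs
  then obtain c L B where L: "linear L" and bil: "bilinear B" and sym: "\<And>v w. B v w = B w v"
    and inv: "J_invariant B" and tr: "(\<Sum>i\<in>UNIV. B (axis i 1) (axis i 1)) = 0"
    and h: "\<And>z. h z = c + L z + B z z / 2"
    unfolding Sym2_def by blast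
  \<comment> \<open>This skew-symmetry makes the matrix \<open>a\<close> below hermitian; its
    diagonal case makes the diagonal entries real, so the trace of \<open>a\<close> is that of
    \<open>B\<close> over the standard axes.\<close>
  have skew: "B (cJ v) w = - B (cJ w) v" for v w
    using J_invariantD[OF inv, of "cJ v" w] sym[of v "cJ w"] by (simp add: bilinear_lneg[OF bil])
  have skew0: "B (cJ v) v = 0" for v
    using skew[of v v] by simp
  \<comment> \<open>Chosen so that \<open>L z\<close> is twice the real part of the sum of
    \<open>b $ k * z $ k\<close>.\<close>
  define b :: "complex^'n" where "b = (\<chi> k. Complex (L (axis k 1)) (- L (cJ (axis k 1))) / 2)"
  define a :: "complex^'n^'n" where
    "a = (\<chi> i j. Complex (B (axis i 1) (axis j 1)) (- B (cJ (axis i 1)) (axis j 1)))"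
  have herm: "a $ j $ i = cnj (a $ i $ j)" for i j
    using skew[of "axis i 1" "axis j 1"] sym[of "axis i 1" "axis j 1"] by (simp add: a_def complex_eq_iff)
  have tra: "trace a = 0"
    using tr by (simp add: trace_def a_def complex_eq_iff skew0 del: cJ_axis_1)
  have "complex_of_real (Re (z $ k) * L (axis k 1) + Im (z $ k) * L (cJ (axis k 1))) =
      b $ k * z $ k + cnj (b $ k) * cnj (z $ k)" for z k
    by (simp add: complex_eq_iff b_def field_simps del: cJ_axis_1)
  then have Lz: "complex_of_real (L z) = (\<Sum>k\<in>UNIV. b $ k * z $ k + cnj (b $ k) * cnj (z $ k))" for z
    by (simp only: linear_complex_vec[OF L, of z] of_real_sum)
  \<comment> \<open>Real parts agree by expanding \<open>B\<close> in both arguments over the axes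
    and their images under J; the imaginary part of the sum vanishes because a hermitian sum equals
    its own conjugate.\<close>
  have Bz: "complex_of_real (B z z) = (\<Sum>i\<in>UNIV. \<Sum>j\<in>UNIV. a $ i $ j * z $ i * cnj (z $ j))"
    (is "_ = ?S") for z
  proof (rule complex_eqI)
    have right: "B v w = (\<Sum>j\<in>UNIV. Re (w $ j) * B v (axis j 1) + Im (w $ j) * B v (cJ (axis j 1)))" for v w
      using bil by (intro linear_complex_vec) (simp add: bilinear_def)
    have left: "B v w = (\<Sum>j\<in>UNIV. Re (v $ j) * B (axis j 1) w + Im (v $ j) * B (cJ (axis j 1)) w)" for v w
      using bil by (intro linear_complex_vec[of "\<lambda>v. B v w"]) (simp add: bilinear_def)
    have entry: "Re (z $ i) * B (axis i 1) (axis j 1) * Re (z $ j)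
        + Im (z $ i) * B (cJ (axis i 1)) (axis j 1) * Re (z $ j)
        + (Re (z $ i) * B (axis i 1) (cJ (axis j 1)) * Im (z $ j)
        + Im (z $ i) * B (cJ (axis i 1)) (cJ (axis j 1)) * Im (z $ j))
        = Re (a $ i $ j * z $ i * cnj (z $ j))" for i j
    proof -
      have "B (axis i 1) (cJ (axis j 1)) = - B (cJ (axis i 1)) (axis j 1)"
        using skew[of "axis i 1" "axis j 1"] sym[of "axis i 1" "cJ (axis j 1)"] by linarith
      then show ?thesis
        unfolding J_invariantD[OF inv] by (simp add: a_def algebra_simps del: cJ_axis_1)
    qed
    have "B z z = (\<Sum>j\<in>UNIV. Re (z $ j) * B z (axis j 1) + Im (z $ j) * B z (cJ (axis j 1)))"
      by (rule right)
    also have "\<dots> = (\<Sum>j\<in>UNIV. \<Sum>i\<in>UNIV. Re (a $ i $ j * z $ i * cnj (z $ j)))"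
      unfolding left[of z] entry[symmetric]
      by (simp only: sum.distrib distrib_left distrib_right sum_distrib_left sum_distrib_right ac_simps)
    also have "\<dots> = Re ?S"
      by (subst sum.swap) (simp only: Re_sum)
    finally show "Re (complex_of_real (B z z)) = Re ?S"
      by (simp only: Re_complex_of_real)
    have "cnj ?S = (\<Sum>i\<in>UNIV. \<Sum>j\<in>UNIV. a $ j $ i * z $ j * cnj (z $ i))"
      unfolding cnj_sum complex_cnj_mult complex_cnj_cnj herm[symmetric] by (simp only: ac_simps)
    also have "\<dots> = ?S"
      by (rule sum.swap)
    finally have "Im (cnj ?S) = Im ?S"
      by (rule arg_cong)
    then show "Im (complex_of_real (B z z)) = Im ?S"
      by (simp only: cnj.sel Im_complex_of_real neg_equal_zero)
  qed
  show "traceless_hermitian_poly h"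
    unfolding traceless_hermitian_poly_def
  proof (intro exI conjI allI)
    show "a $ j $ i = cnj (a $ i $ j)" for i j
      by (rule herm)
    show "trace a = 0"
      by (rule tra)
    show "complex_of_real (h z) = complex_of_real c
           + (\<Sum>k\<in>UNIV. b $ k * z $ k + cnj (b $ k) * cnj (z $ k))
           + 1/2 * (\<Sum>i\<in>UNIV. \<Sum>j\<in>UNIV. a $ i $ j * z $ i * cnj (z $ j))" for z
      by (simp add: h flip: Lz Bz)
  qed
qed

subsection \<open>Second-order calculus\<close>

lemma C_k_on_const: "C_k_on k U (\<lambda>x. c)"
  by (induction k arbitrary: c) simp_all

text \<open>The first derivative in direction \<open>v\<close> is the affine function
  \<open>L v + B v y\<close> of \<open>y\<close>, where symmetry of \<open>B\<close> cancels the
  factor 1/2. The second derivatives are constant and all later ones vanish.\<close>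

lemma smooth_on_quadratic:
  fixes L :: "'a::euclidean_space \<Rightarrow> real"
  assumes L: "linear L" and B: "B \<in> Sym2"
  shows "smooth_on U (\<lambda>y. c + L y + B y y / 2)"
    and "hessian_at (\<lambda>y. c + L y + B y y / 2) x = B"
proof -
  have bil: "bounded_bilinear B"
    using B by (simp add: Sym2_def bilinear_conv_bounded_bilinear)
  have aff: "((\<lambda>y. d + M y) has_derivative M) (at y)" if "linear M" for d y and M :: "'a \<Rightarrow> real"
    using that by (auto intro!: derivative_eq_intros bounded_linear_imp_has_derivative
        simp: linear_conv_bounded_linear)
  have quad: "((\<lambda>y. c + L y + B y y / 2) has_derivative (\<lambda>v. L v + B v y)) (at y)" for y
  proof -
    have "((\<lambda>y. B y y) has_derivative (\<lambda>v. B y v + B v y)) (at y)"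
      using bounded_bilinear.FDERIV[OF bil has_derivative_ident has_derivative_ident] by simp
    then have "((\<lambda>y. c + L y + B y y / 2) has_derivative (\<lambda>v. L v + (B y v + B v y) / 2)) (at y)"
      by (intro has_derivative_add aff L) (auto intro!: derivative_eq_intros)
    moreover have "(\<lambda>v. L v + (B y v + B v y) / 2) = (\<lambda>v. L v + B v y)"
      using B by (auto simp: Sym2_def)
    ultimately show ?thesis by simp
  qed
  have fd: "frechet_derivative (\<lambda>y. c + L y + B y y / 2) (at y) = (\<lambda>v. L v + B v y)" for y
    using frechet_derivative_at[OF quad] by simp
  have lin: "linear (B v)" for v
    using B by (simp add: Sym2_def bilinear_def)
  have fda: "frechet_derivative (\<lambda>y. L v + B v y) (at y) = B v" for y v
    using frechet_derivative_at[OF aff[OF lin]] by metis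
  show "hessian_at (\<lambda>y. c + L y + B y y / 2) x = B"
    by (simp add: hessian_at_def fd fda fun_eq_iff)
  have cont: "continuous_on U (\<lambda>y. c + L y + B y y / 2)" "continuous_on U (\<lambda>y. L v + B v y)" for v
    using has_derivative_continuous_on[OF has_derivative_at_withinI[OF quad]]
      has_derivative_continuous_on[OF has_derivative_at_withinI[OF aff[OF lin]]] .
  have "C_k_on k U (\<lambda>y. L v + B v y)" for k v
    using cont
    by (cases k) (auto simp: fda C_k_on_const intro: differentiableI[OF aff[OF lin]])
  then have "C_k_on k U (\<lambda>y. c + L y + B y y / 2)" for k
    using cont by (cases k) (auto simp: fd intro: differentiableI[OF quad])
  then show "smooth_on U (\<lambda>y. c + L y + B y y / 2)"
    by (simp add: smooth_on_def)
qed

section \<open>Symmetry of the Hessian\<close>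

lemma C_2_onD:
  assumes "C_k_on (Suc (Suc 0)) U f"
  shows "\<And>x. x \<in> U \<Longrightarrow> (f has_derivative frechet_derivative f (at x)) (at x)"
    and "\<And>x v. x \<in> U \<Longrightarrow> ((\<lambda>y. frechet_derivative f (at y) v) has_derivative hessian_at f x v) (at x)"
    and "\<And>v w. continuous_on U (\<lambda>x. hessian_at f x v w)"
  using assms by (auto simp: hessian_at_def[abs_def] frechet_derivative_works[symmetric])

text \<open>Two applications of the mean value theorem: along \<open>v\<close> to the increment of
  \<open>f\<close> in direction \<open>w\<close>, then along \<open>w\<close> to the derivative in
  direction \<open>v\<close>.\<close>

lemma mixed_second_difference:
  fixes f :: "'a::euclidean_space \<Rightarrow> real"
  assumes C2: "C_k_on (Suc (Suc 0)) U f" and "0 < s"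
    and U: "\<And>a b. 0 \<le> a \<Longrightarrow> a \<le> s \<Longrightarrow> 0 \<le> b \<Longrightarrow> b \<le> s \<Longrightarrow> x + a *\<^sub>R v + b *\<^sub>R w \<in> U"
  obtains a b where "0 \<le> a" "a \<le> s" "0 \<le> b" "b \<le> s"
    "f (x + s *\<^sub>R v + s *\<^sub>R w) - f (x + s *\<^sub>R v) - f (x + s *\<^sub>R w) + f x =
       s\<^sup>2 * hessian_at f (x + a *\<^sub>R v + b *\<^sub>R w) v w"
proof -
  note D = C_2_onD[OF C2]
  let ?D = "\<lambda>y. frechet_derivative f (at y)"
  have lin: "linear (?D y)" "linear (hessian_at f y v)" if "y \<in> U" for y
    using D(1)[OF that] D(2)[OF that, of v] has_derivative_linear by blast+
  have d1: "((\<lambda>a. f (x + a *\<^sub>R v + b *\<^sub>R w)) has_real_derivative ?D (x + a *\<^sub>R v + b *\<^sub>R w) v) (at a)"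
    if "x + a *\<^sub>R v + b *\<^sub>R w \<in> U" for a b
  proof -
    have "((\<lambda>a. x + a *\<^sub>R v + b *\<^sub>R w) has_derivative (\<lambda>t. t *\<^sub>R v)) (at a)"
      by (auto intro!: derivative_eq_intros)
    from has_derivative_compose[OF this D(1)[OF that]]
    have "((\<lambda>a. f (x + a *\<^sub>R v + b *\<^sub>R w)) has_derivative (\<lambda>t. ?D (x + a *\<^sub>R v + b *\<^sub>R w) (t *\<^sub>R v))) (at a)" .
    moreover have "(\<lambda>t. ?D (x + a *\<^sub>R v + b *\<^sub>R w) (t *\<^sub>R v)) = (*) (?D (x + a *\<^sub>R v + b *\<^sub>R w) v)"
      using linear_cmul[OF lin(1)[OF that]] by (auto simp: mult.commute)
    ultimately show ?thesis
      by (simp add: has_field_derivative_def)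
  qed
  have d2: "((\<lambda>b. ?D (x + a *\<^sub>R v + b *\<^sub>R w) v) has_real_derivative
        hessian_at f (x + a *\<^sub>R v + b *\<^sub>R w) v w) (at b)"
    if "x + a *\<^sub>R v + b *\<^sub>R w \<in> U" for a b
  proof -
    have "((\<lambda>b. x + a *\<^sub>R v + b *\<^sub>R w) has_derivative (\<lambda>t. t *\<^sub>R w)) (at b)"
      by (auto intro!: derivative_eq_intros)
    from has_derivative_compose[OF this D(2)[OF that]]
    have "((\<lambda>b. ?D (x + a *\<^sub>R v + b *\<^sub>R w) v) has_derivative
      (\<lambda>t. hessian_at f (x + a *\<^sub>R v + b *\<^sub>R w) v (t *\<^sub>R w))) (at b)" .
    moreover have "(\<lambda>t. hessian_at f (x + a *\<^sub>R v + b *\<^sub>R w) v (t *\<^sub>R w)) =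
      (*) (hessian_at f (x + a *\<^sub>R v + b *\<^sub>R w) v w)"
      using linear_cmul[OF lin(2)[OF that]] by (auto simp: mult.commute)
    ultimately show ?thesis
      by (simp add: has_field_derivative_def)
  qed
  let ?G = "\<lambda>a. f (x + a *\<^sub>R v + s *\<^sub>R w) - f (x + a *\<^sub>R v + 0 *\<^sub>R w)"
  have "\<exists>a. 0 < a \<and> a < s \<and> ?G s - ?G 0 = (s - 0) *
      (?D (x + a *\<^sub>R v + s *\<^sub>R w) v - ?D (x + a *\<^sub>R v + 0 *\<^sub>R w) v)"
    using U[of _ s] U[of _ 0] \<open>0 < s\<close> by (intro MVT2 DERIV_diff d1) auto
  then obtain a where a: "0 < a" "a < s" "?G s - ?G 0 =
      s * (?D (x + a *\<^sub>R v + s *\<^sub>R w) v - ?D (x + a *\<^sub>R v + 0 *\<^sub>R w) v)"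
    by auto
  have "\<exists>b. 0 < b \<and> b < s \<and> ?D (x + a *\<^sub>R v + s *\<^sub>R w) v - ?D (x + a *\<^sub>R v + 0 *\<^sub>R w) v
      = (s - 0) * hessian_at f (x + a *\<^sub>R v + b *\<^sub>R w) v w"
    using U \<open>0 < s\<close> a by (intro MVT2 d2) auto
  then obtain b where b: "0 < b" "b < s" "?D (x + a *\<^sub>R v + s *\<^sub>R w) v - ?D (x + a *\<^sub>R v + 0 *\<^sub>R w) v
      = s * hessian_at f (x + a *\<^sub>R v + b *\<^sub>R w) v w"
    by auto
  show thesis
    by (rule that[of a b]) (use a b in \<open>auto simp: power2_eq_square\<close>)
qed

text \<open>The mixed second difference is symmetric in \<open>v\<close> and \<open>w\<close>.
  Evaluating it in both orders equates Hessian values at two points near \<open>x\<close>;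
  continuity of the second derivatives transfers this to \<open>x\<close>.\<close>

lemma hessian_at_symmetric:
  fixes f :: "'a::euclidean_space \<Rightarrow> real"
  assumes "open U" "x \<in> U" and C2: "C_k_on (Suc (Suc 0)) U f"
  shows "hessian_at f x v w = hessian_at f x w v"
proof (rule ccontr)
  assume neq: "hessian_at f x v w \<noteq> hessian_at f x w v"
  define \<epsilon> where "\<epsilon> = \<bar>hessian_at f x v w - hessian_at f x w v\<bar> / 2"
  have "0 < \<epsilon>" using neq by (simp add: \<epsilon>_def)
  have "\<exists>d>0. \<forall>y. dist y x < d \<longrightarrow> y \<in> U \<and> \<bar>hessian_at f y v w - hessian_at f x v w\<bar> < \<epsilon>" for v w
  proof -
    have "continuous (at x) (\<lambda>y. hessian_at f y v w)"
      using C_2_onD(3)[OF C2] assms continuous_on_eq_continuous_at by blast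
    then obtain d where "d > 0" "\<And>y. dist y x < d \<Longrightarrow> \<bar>hessian_at f y v w - hessian_at f x v w\<bar> < \<epsilon>"
      using \<open>0 < \<epsilon>\<close> unfolding continuous_at_eps_delta dist_real_def by metis
    moreover obtain d' where "d' > 0" "\<And>y. dist y x < d' \<Longrightarrow> y \<in> U"
      using assms(1,2) unfolding open_dist by blast
    ultimately show ?thesis
      by (intro exI[of _ "min d d'"]) auto
  qed
  then obtain d1 d2 where d: "d1 > 0" "d2 > 0"
    and d1: "\<And>y. dist y x < d1 \<Longrightarrow> y \<in> U \<and> \<bar>hessian_at f y v w - hessian_at f x v w\<bar> < \<epsilon>"
    and d2: "\<And>y. dist y x < d2 \<Longrightarrow> y \<in> U \<and> \<bar>hessian_at f y w v - hessian_at f x w v\<bar> < \<epsilon>"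
    by metis
  \<comment> \<open>Small enough that the whole parallelogram with sides
    \<open>s *\<^sub>R v\<close> and \<open>s *\<^sub>R w\<close> lies within both radii.\<close>
  define s where "s = min d1 d2 / (2 * (norm v + norm w + 1))"
  have pos: "norm v + norm w + 1 > 0" by (simp add: add_nonneg_pos)
  have "s > 0" using d pos by (simp add: s_def)
  have close: "dist (x + a *\<^sub>R v' + b *\<^sub>R w') x < min d1 d2"
    if "0 \<le> a" "a \<le> s" "0 \<le> b" "b \<le> s" "norm v' + norm w' = norm v + norm w" for a b v' w'
  proof -
    have "dist (x + a *\<^sub>R v' + b *\<^sub>R w') x \<le> a * norm v' + b * norm w'"
      using that norm_triangle_ineq[of "a *\<^sub>R v'" "b *\<^sub>R w'"] by (simp add: dist_norm)
    also have "\<dots> \<le> s * norm v' + s * norm w'"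
      using that by (intro add_mono mult_right_mono) auto
    also have "\<dots> = s * (norm v + norm w)"
      using that(5) by (metis distrib_left)
    also have "\<dots> < s * (2 * (norm v + norm w + 1))"
    proof (rule mult_strict_left_mono)
      show "norm v + norm w < 2 * (norm v + norm w + 1)"
        using pos unfolding distrib_left by linarith
    qed fact
    also have "\<dots> = min d1 d2"
      using pos by (simp add: s_def)
    finally show ?thesis .
  qed
  obtain a b where ab: "0 \<le> a" "a \<le> s" "0 \<le> b" "b \<le> s" and
    1: "f (x + s *\<^sub>R v + s *\<^sub>R w) - f (x + s *\<^sub>R v) - f (x + s *\<^sub>R w) + f x =
       s\<^sup>2 * hessian_at f (x + a *\<^sub>R v + b *\<^sub>R w) v w"
    by (rule mixed_second_difference[OF C2 \<open>0 < s\<close>, of x v w]) (use close[of _ _ v w] d1 in auto)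
  obtain a' b' where ab': "0 \<le> a'" "a' \<le> s" "0 \<le> b'" "b' \<le> s" and
    2: "f (x + s *\<^sub>R w + s *\<^sub>R v) - f (x + s *\<^sub>R w) - f (x + s *\<^sub>R v) + f x =
       s\<^sup>2 * hessian_at f (x + a' *\<^sub>R w + b' *\<^sub>R v) w v"
    by (rule mixed_second_difference[OF C2 \<open>0 < s\<close>, of x w v]) (use close[of _ _ w v] d1 in auto)
  have "s\<^sup>2 * hessian_at f (x + a *\<^sub>R v + b *\<^sub>R w) v w = s\<^sup>2 * hessian_at f (x + a' *\<^sub>R w + b' *\<^sub>R v) w v"
    using 1 2 by (simp add: algebra_simps)
  then have "hessian_at f (x + a *\<^sub>R v + b *\<^sub>R w) v w = hessian_at f (x + a' *\<^sub>R w + b' *\<^sub>R v) w v"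
    using \<open>s > 0\<close> by simp
  moreover have "\<bar>hessian_at f (x + a *\<^sub>R v + b *\<^sub>R w) v w - hessian_at f x v w\<bar> < \<epsilon>"
    using close[OF ab] d1 by simp
  moreover have "\<bar>hessian_at f (x + a' *\<^sub>R w + b' *\<^sub>R v) w v - hessian_at f x w v\<bar> < \<epsilon>"
    using close[OF ab', of w v] d2 by simp
  ultimately show False
    unfolding \<epsilon>_def by (smt (verit) field_sum_of_halves)
qed

lemma hessian_at_Sym2:
  fixes f :: "'a::euclidean_space \<Rightarrow> real"
  assumes "open U" "x \<in> U" and C2: "C_k_on (Suc (Suc 0)) U f"
  shows "hessian_at f x \<in> Sym2"
proof -
  have "linear (hessian_at f x v)" for v
    using C_2_onD(2)[OF C2 assms(2)] has_derivative_linear by blast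
  moreover have "hessian_at f x v w = hessian_at f x w v" for v w
    by (rule hessian_at_symmetric[OF assms])
  ultimately show ?thesis
    by (simp add: Sym2_def bilinear_def)
qed

section \<open>Second-order Taylor estimate\<close>

lemma bilinear_bound:
  fixes Q :: "'a::euclidean_space \<Rightarrow> 'a \<Rightarrow> real" and \<delta> :: real
  assumes Q: "bilinear Q" and le: "\<And>b c. b \<in> Basis \<Longrightarrow> c \<in> Basis \<Longrightarrow> \<bar>Q b c\<bar> \<le> \<delta>"
  shows "Q v v \<le> (real DIM('a))\<^sup>2 * \<delta> * (norm v)\<^sup>2"
proof -
  have "Q v v = (\<Sum>(b,c)\<in>Basis \<times> Basis. Q ((v \<bullet> b) *\<^sub>R b) ((v \<bullet> c) *\<^sub>R c))"
    using bilinear_sum[OF Q, of "\<lambda>b. (v \<bullet> b) *\<^sub>R b" Basis "\<lambda>b. (v \<bullet> b) *\<^sub>R b" Basis]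
    by (simp add: euclidean_representation)
  also have "\<dots> \<le> (\<Sum>(b,c)\<in>(Basis::'a set) \<times> (Basis::'a set). \<delta> * (norm v)\<^sup>2)"
  proof (rule sum_mono, clarify)
    fix b c :: 'a assume bc: "b \<in> Basis" "c \<in> Basis"
    have "Q ((v \<bullet> b) *\<^sub>R b) ((v \<bullet> c) *\<^sub>R c) \<le> \<bar>v \<bullet> b\<bar> * (\<bar>v \<bullet> c\<bar> * \<bar>Q b c\<bar>)"
      using abs_ge_self[of "(v \<bullet> b) * ((v \<bullet> c) * Q b c)"]
      by (simp add: bilinear_lmul[OF Q] bilinear_rmul[OF Q] abs_mult ac_simps)
    also have "\<dots> \<le> norm v * (norm v * \<delta>)"
      using bc le[OF bc] by (intro mult_mono) (auto simp: Basis_le_norm)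
    finally show "Q ((v \<bullet> b) *\<^sub>R b) ((v \<bullet> c) *\<^sub>R c) \<le> \<delta> * (norm v)\<^sup>2"
      by (simp add: power2_eq_square ac_simps)
  qed
  also have "\<dots> = (real DIM('a))\<^sup>2 * \<delta> * (norm v)\<^sup>2"
    by (simp add: power2_eq_square)
  finally show ?thesis .
qed

text \<open>The Lagrange remainder along the segment involves the Hessian at an intermediate point,
  which continuity compares with the Hessian at \<open>x\<close>.\<close>

lemma Taylor_second_order_le:
  fixes f :: "'a::euclidean_space \<Rightarrow> real"
  assumes "open U" "x \<in> U" and C2: "C_k_on (Suc (Suc 0)) U f" and "0 < \<epsilon>"
  obtains r where "0 < r" "\<And>v. norm v \<le> r \<Longrightarrow> f (x + v) \<le>
    f x + frechet_derivative f (at x) v + hessian_at f x v v / 2 + \<epsilon> * (norm v)\<^sup>2"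
proof -
  note D = C_2_onD[OF C2]
  let ?H = "hessian_at f"
  \<comment> \<open>An entrywise error \<open>\<delta>\<close> in the Hessian costs at most
    \<open>\<epsilon> * (norm v)\<^sup>2\<close> by \<open>bilinear_bound\<close>.\<close>
  define \<delta> where "\<delta> = \<epsilon> / (real DIM('a))\<^sup>2"
  have "\<delta> > 0" using \<open>0 < \<epsilon>\<close> by (simp add: \<delta>_def)
  have "\<forall>\<^sub>F y in at x. \<bar>?H y b c - ?H x b c\<bar> \<le> \<delta>" for b c
  proof -
    have "((\<lambda>y. ?H y b c) \<longlongrightarrow> ?H x b c) (at x)"
      using D(3)[of b c] assms(1,2) by (simp add: continuous_on_eq_continuous_at continuous_at)
    then show ?thesis
      using tendstoD[OF _ \<open>\<delta> > 0\<close>] by (force simp: dist_real_def elim: eventually_mono)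
  qed
  then have "\<forall>\<^sub>F y in at x. \<forall>b\<in>Basis. \<forall>c\<in>Basis. \<bar>?H y b c - ?H x b c\<bar> \<le> \<delta>"
    by (simp add: eventually_ball_finite_distrib)
  moreover have "\<forall>\<^sub>F y in at x. y \<in> U"
    using assms(1,2) by (simp add: eventually_at_in_open')
  ultimately have "\<forall>\<^sub>F y in at x. y \<in> U \<and> (\<forall>b\<in>Basis. \<forall>c\<in>Basis. \<bar>?H y b c - ?H x b c\<bar> \<le> \<delta>)"
    by eventually_elim auto
  then obtain d where "d > 0" and d: "\<And>y. y \<noteq> x \<Longrightarrow> dist y x < d \<Longrightarrow>
      y \<in> U \<and> (\<forall>b\<in>Basis. \<forall>c\<in>Basis. \<bar>?H y b c - ?H x b c\<bar> \<le> \<delta>)"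
    unfolding eventually_at by auto
  have d': "y \<in> U" "b \<in> Basis \<Longrightarrow> c \<in> Basis \<Longrightarrow> \<bar>?H y b c - ?H x b c\<bar> \<le> \<delta>"
    if "dist y x < d" for y b c
    using d[of y] that assms(2) \<open>\<delta> > 0\<close> by (cases "y = x"; auto)+
  have bound: "?H y v v \<le> ?H x v v + \<epsilon> * (norm v)\<^sup>2" if "dist y x < d" for y v
  proof -
    have "bilinear (?H y)" "bilinear (?H x)"
      using hessian_at_Sym2[OF assms(1) _ C2] d'[OF that] assms(2) by (auto simp: Sym2_def)
    then have "bilinear (\<lambda>a b. ?H y a b - ?H x a b)"
      by (auto simp: bilinear_def intro!: linear_compose_sub)
    from bilinear_bound[OF this d'(2)[OF that], of v] show ?thesis
      by (simp add: \<delta>_def)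
  qed
  show thesis
  proof
    show "0 < d / 2" using \<open>d > 0\<close> by simp
    fix v :: 'a assume v: "norm v \<le> d / 2"
    let ?g = "\<lambda>m t. if m = (0::nat) then f (x + t *\<^sub>R v) else if m = 1 then
      frechet_derivative f (at (x + t *\<^sub>R v)) v else ?H (x + t *\<^sub>R v) v v"
    have cl: "dist (x + t *\<^sub>R v) x < d" if "0 \<le> t" "t \<le> 1" for t
    proof -
      have "t * norm v \<le> 1 * norm v" using that by (intro mult_right_mono) auto
      then show ?thesis
        using v \<open>d > 0\<close> that by (simp add: dist_norm)
    qed
    have "DERIV (?g m) t :> ?g (Suc m) t" if "m < 2" "0 \<le> t" "t \<le> 1" for m t
    proof -
      have inU: "x + t *\<^sub>R v \<in> U"
        using d'(1)[OF cl] that by simp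
      have line: "((\<lambda>t. x + t *\<^sub>R v) has_derivative (\<lambda>s. s *\<^sub>R v)) (at t)"
        by (auto intro!: derivative_eq_intros)
      have *: "((\<lambda>t. F (x + t *\<^sub>R v)) has_real_derivative F' v) (at t)"
        if "(F has_derivative F') (at (x + t *\<^sub>R v))" for F F'
      proof -
        have "((\<lambda>t. F (x + t *\<^sub>R v)) has_derivative (\<lambda>s. F' (s *\<^sub>R v))) (at t)"
          using has_derivative_compose[OF line that] .
        moreover have "(\<lambda>s. F' (s *\<^sub>R v)) = (*) (F' v)"
          using linear_cmul[OF has_derivative_linear[OF that]] by (auto simp: mult.commute)
        ultimately show ?thesis
          by (simp add: has_field_derivative_def)
      qed
      from *[OF D(1)[OF inU]] *[OF D(2)[OF inU]] \<open>m < 2\<close> show ?thesis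
        by (cases m) auto
    qed
    then obtain t where t: "0 < t" "t < 1" "f (x + 1 *\<^sub>R v) =
       (\<Sum>m<2. ?g m 0 / fact m * 1 ^ m) + ?g 2 t / fact 2 * 1 ^ 2"
      using Maclaurin[of 1 2 ?g "\<lambda>t. f (x + t *\<^sub>R v)"] by auto
    then have "f (x + v) = f x + frechet_derivative f (at x) v + ?H (x + t *\<^sub>R v) v v / 2"
      by (simp add: numeral_2_eq_2)
    moreover have "?H (x + t *\<^sub>R v) v v \<le> ?H x v v + \<epsilon> * (norm v)\<^sup>2"
      using bound cl t by simp
    \<comment> \<open>The remainder only carries half of the error; this rounds it up.\<close>
    moreover have "0 \<le> \<epsilon> * (norm v)\<^sup>2" using \<open>0 < \<epsilon>\<close> by simp
    ultimately show "f (x + v) \<le>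
        f x + frechet_derivative f (at x) v + ?H x v v / 2 + \<epsilon> * (norm v)\<^sup>2"
      by linarith
  qed
qed

subsection \<open>The three conditions\<close>

lemma usc_on_openin:
  assumes "usc_on K u"
  shows "openin (top_of_set K) {x\<in>K. u x < t}"
proof (subst openin_subopen, clarify)
  fix x assume "x \<in> K" "u x < t"
  then have "\<forall>\<^sub>F y in at x within K. u y < t"
    using assms unfolding usc_on_def by blast
  then obtain S where S: "open S" "x \<in> S" "\<And>y. y \<in> S \<Longrightarrow> y \<noteq> x \<Longrightarrow> y \<in> K \<Longrightarrow> u y < t"
    unfolding eventually_at_topological by blast
  show "\<exists>T. openin (top_of_set K) T \<and> x \<in> T \<and> T \<subseteq> {x\<in>K. u x < t}"
  proof (intro exI conjI)
    show "openin (top_of_set K) (K \<inter> S)"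
      using S(1) by (rule openin_open_Int)
    show "K \<inter> S \<subseteq> {x\<in>K. u x < t}"
      using S(3) \<open>u x < t\<close> by blast
  qed (use S(2) \<open>x \<in> K\<close> in blast)
qed

text \<open>Without a maximum, the relatively open sets where \<open>u < u y\<close> cover
  \<open>K\<close>. In a finite subcover, the index with the largest value of \<open>u\<close> would
  lie in one of the sets, hence be exceeded by another index.\<close>

lemma usc_on_attains_sup:
  assumes "compact K" "K \<noteq> {}" "usc_on K u"
  obtains x where "x \<in> K" "\<And>y. y \<in> K \<Longrightarrow> u y \<le> u x"
proof (rule ccontr)
  assume "\<not> thesis"
  then have *: "\<exists>y\<in>K. u x < u y" if "x \<in> K" for x
    using \<open>x \<in> K\<close> \<open>\<And>x. x \<in> K \<Longrightarrow> (\<And>y. y \<in> K \<Longrightarrow> u y \<le> u x) \<Longrightarrow> thesis\<close>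
    by (meson not_le)
  have "\<exists>T. open T \<and> {x\<in>K. u x < u y} = K \<inter> T" for y
    using usc_on_openin[OF assms(3)] unfolding openin_open by blast
  then obtain T where T: "\<And>y. open (T y)" "\<And>y. {x\<in>K. u x < u y} = K \<inter> T y"
    by metis
  have "K \<subseteq> (\<Union>y\<in>K. T y)"
    using * T(2) by blast
  then obtain D where D: "D \<subseteq> K" "finite D" "K \<subseteq> (\<Union>y\<in>D. T y)"
    using compactE_image[OF assms(1), of K T] T(1) by metis
  then have "D \<noteq> {}" using assms(2) by auto
  then have "Max (u ` D) \<in> u ` D"
    using D(2) by simp
  then obtain m where m: "m \<in> D" "u m = Max (u ` D)"
    by auto
  then obtain y where "y \<in> D" "m \<in> T y"
    using D by blast
  then have "u m < u y"
    using T(2)[of y] m D by blast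
  moreover have "u y \<le> u m"
    using m(2) D(2) \<open>y \<in> D\<close> by simp
  ultimately show False
    by simp
qed

lemma usc_on_subset: "usc_on X u \<Longrightarrow> Y \<subseteq> X \<Longrightarrow> usc_on Y u"
  unfolding usc_on_def using filter_leD[OF at_le] by blast

lemma usc_on_add_continuous:
  assumes u: "usc_on X u" and g: "continuous_on X g"
  shows "usc_on X (\<lambda>x. u x + ereal (g x))"
  unfolding usc_on_def
proof (intro ballI conjI allI impI)
  fix x assume x: "x \<in> X"
  then show fin: "u x + ereal (g x) < \<infinity>"
    using u by (cases "u x") (auto simp: usc_on_def)
  fix t assume "u x + ereal (g x) < t"
  then obtain r where r: "u x + ereal (g x) < ereal r" "ereal r < t"
    using ereal_dense2 by blast
  have "u x < ereal (r - g x)"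
    using r(1) by (cases "u x") auto
  \<comment> \<open>\<open>s\<close> splits the gap: it suffices that \<open>u y < s\<close> and
    \<open>g y < r - s\<close> near \<open>x\<close>.\<close>
  then obtain s where s: "u x < ereal s" "s < r - g x"
    using ereal_dense2[of "u x" "ereal (r - g x)"] by auto
  have "\<forall>\<^sub>F y in at x within X. u y < ereal s"
    using u x s unfolding usc_on_def by blast
  moreover have "\<forall>\<^sub>F y in at x within X. g y < r - s"
    using g x s by (intro order_tendstoD(2)[of g "g x"]) (auto simp: continuous_on_def)
  ultimately show "\<forall>\<^sub>F y in at x within X. u y + ereal (g y) < t"
  proof eventually_elim
    case (elim y)
    then have "u y + ereal (g y) < ereal r"
      by (cases "u y") auto
    then show ?case using r by simp
  qed
qed

section \<open>From test functions to comparison with polynomials\<close>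

lemma bilinear_inner: "bilinear (\<lambda>v w. c * (v \<bullet> w))"
  by (auto simp: bilinear_def inner_add algebra_simps intro!: linearI)

lemma dually_Lagrangian_psh_imp_sub:
  fixes X :: "(complex^'n) set"
  assumes u: "usc_on X u" and psh: "dually_Lagrangian_psh X u"
  shows "sub_traceless_hermitian X u"
  unfolding sub_traceless_hermitian_def
proof (intro allI impI ballI, elim conjE, rule ccontr)
  fix \<Omega> h and z\<^sub>0 :: "complex^'n"
  assume "open \<Omega>" and comp: "compact (closure \<Omega>)" and sub: "closure \<Omega> \<subseteq> X"
    and "traceless_hermitian_poly h" and bd: "\<forall>z\<in>frontier \<Omega>. u z \<le> ereal (h z)"
    and z0: "z\<^sub>0 \<in> closure \<Omega>" "\<not> u z\<^sub>0 \<le> ereal (h z\<^sub>0)"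
  obtain c L B where L: "linear L" and B: "B \<in> Sym2" "J_invariant B"
      "(\<Sum>i\<in>UNIV. B (axis i 1) (axis i 1)) = 0" and h: "\<And>z. h z = c + L z + B z z / 2"
    using \<open>traceless_hermitian_poly h\<close> unfolding traceless_hermitian_poly_iff by blast
  have bil: "bilinear B" using B by (simp add: Sym2_def)
  have fin: "u z < \<infinity>" if "z \<in> closure \<Omega>" for z
    using u sub that unfolding usc_on_def by blast
  obtain s where s: "u z\<^sub>0 = ereal s" "h z\<^sub>0 < s"
    using z0(2) fin[OF z0(1)] by (cases "u z\<^sub>0") auto
  define d where "d = s - h z\<^sub>0"
  have d: "u z\<^sub>0 = ereal (h z\<^sub>0 + d)" "d > 0"
    using s by (simp_all add: d_def)
  obtain R where R: "\<And>z. z \<in> closure \<Omega> \<Longrightarrow> norm z \<le> R"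
    using compact_imp_bounded[OF comp] unfolding bounded_iff by blast
  \<comment> \<open>On the closure of \<open>\<Omega>\<close> the perturbation
    \<open>\<epsilon> * (norm z)\<^sup>2\<close> stays below the excess \<open>d\<close> of
    \<open>u\<close> over \<open>h\<close> at \<open>z\<^sub>0\<close>.\<close>
  define \<epsilon> where "\<epsilon> = d / (2 * (R\<^sup>2 + 1))"
  have "R\<^sup>2 + 1 > 0" by (simp add: add_nonneg_pos)
  then have "\<epsilon> > 0" and \<epsilon>R: "\<epsilon> * R\<^sup>2 < d"
    using d(2) by (simp_all add: \<epsilon>_def field_simps add_pos_nonneg)
  \<comment> \<open>The Hessian of \<open>h z - \<epsilon> * (norm z)\<^sup>2\<close>; the function
    \<open>g\<close> below is the negative of this polynomial.\<close>
  define B' where "B' v w = B v w - 2 * \<epsilon> * (v \<bullet> w)" for v w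
  have "bilinear B'"
    unfolding bilinear_def B'_def using bil bilinear_inner[of "2 * \<epsilon>"]
    by (auto simp: bilinear_def intro!: linear_compose_sub)
  moreover have "B v w = B w v" for v w
    using B(1) unfolding Sym2_def by blast
  then have "B' v w = B' w v" for v w
    by (simp only: B'_def inner_commute)
  ultimately have B': "B' \<in> Sym2"
    unfolding Sym2_def by blast
  define g where "g z = - (c + L z + B' z z / 2)" for z
  have h_eq: "h z = \<epsilon> * (norm z)\<^sup>2 - g z" for z
    by (simp add: h g_def B'_def field_simps dot_square_norm)
  have "C_k_on 0 (closure \<Omega>) (\<lambda>z. c + L z + B' z z / 2)"
    using smooth_on_quadratic(1)[OF L B'] unfolding smooth_on_def by blast
  then have "continuous_on (closure \<Omega>) g"
    unfolding g_def C_k_on.simps by (rule continuous_on_minus)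
  then have usc: "usc_on (closure \<Omega>) (\<lambda>z. u z + ereal (g z))"
    by (rule usc_on_add_continuous[OF usc_on_subset[OF u sub]])
  obtain x where x: "x \<in> closure \<Omega>"
    and max: "\<And>y. y \<in> closure \<Omega> \<Longrightarrow> u y + ereal (g y) \<le> u x + ereal (g x)"
    by (rule usc_on_attains_sup[OF comp _ usc]) (use z0(1) in auto)
  have "ereal d \<le> u z\<^sub>0 + ereal (g z\<^sub>0)"
    using d \<open>\<epsilon> > 0\<close> by (simp add: h_eq)
  also have "\<dots> \<le> u x + ereal (g x)"
    by (rule max[OF z0(1)])
  finally have ge: "ereal d \<le> u x + ereal (g x)" .
  obtain r where r: "u x = ereal r"
    using ge fin[OF x] by (cases "u x") auto
  \<comment> \<open>On the frontier \<open>u \<le> h\<close>, so there \<open>u + g\<close> is at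
    most \<open>\<epsilon> * R\<^sup>2 < d\<close>, below the maximum.\<close>
  have "x \<in> \<Omega>"
  proof (rule ccontr)
    assume "x \<notin> \<Omega>"
    then have "x \<in> frontier \<Omega>"
      using x \<open>open \<Omega>\<close> by (simp add: frontier_def interior_open)
    then have "r \<le> h x"
      using bd r by auto
    moreover have "\<epsilon> * (norm x)\<^sup>2 \<le> \<epsilon> * R\<^sup>2"
      using R[OF x] \<open>\<epsilon> > 0\<close> by (simp add: power_mono)
    ultimately show False
      using ge r \<epsilon>R h_eq[of x] by simp
  qed
  \<comment> \<open>\<open>- g\<close> raised by the maximum of \<open>u + g\<close>, so that it
    touches \<open>u\<close> from above at \<open>x\<close>.\<close>
  define \<phi> where "\<phi> y = (c + (r + g x)) + L y + B' y y / 2" for y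
  have "\<forall>y\<in>\<Omega>. u y \<le> ereal (\<phi> y)"
  proof
    fix y assume "y \<in> \<Omega>"
    then have "u y + ereal (g y) \<le> ereal (r + g x)"
      using max[of y] closure_subset[of \<Omega>] r by auto
    then show "u y \<le> ereal (\<phi> y)"
      by (cases "u y") (auto simp: \<phi>_def g_def)
  qed
  moreover have "u x = ereal (\<phi> x)"
    by (simp add: r \<phi>_def g_def)
  moreover have "smooth_on \<Omega> \<phi>" "hessian_at \<phi> x = B'"
    using smooth_on_quadratic[OF L B'] by (simp_all add: \<phi>_def[abs_def])
  moreover have "\<Omega> \<subseteq> X" "x \<in> X"
    using sub closure_subset \<open>x \<in> \<Omega>\<close> by blast+
  ultimately have "hessian_at \<phi> x \<in> P_dual_LAG" and hess: "hessian_at \<phi> x = B'"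
    using psh[unfolded dually_Lagrangian_psh_def, rule_format, of x \<Omega> \<phi>] \<open>open \<Omega>\<close> \<open>x \<in> \<Omega>\<close>
    by blast+
  then obtain W where W: "W \<in> LAG" "0 \<le> trace_on W B'"
    unfolding hess P_dual_LAG_def by blast
  then have "subspace W"
    by (simp add: LAG_def)
  then obtain S where S: "orthonormal_basis_of W S"
    using orthonormal_basis_of_exists by blast
  note S' = LAG_basis_unitary[OF W(1) S]
  have "trace_on W B' = (\<Sum>e\<in>S. B e e - 2 * \<epsilon>)"
    using trace_on_eq[OF _ S] \<open>bilinear B'\<close> unitary_familyD(1)[OF S'(1)] by (simp add: B'_def)
  also have "\<dots> = - (2 * \<epsilon> * CARD('n))"
    using J_invariant_trace[OF bil B(2) S'] B(3) S'(2) by (simp add: sum_subtractf)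
  also have "\<dots> < 0"
    using \<open>\<epsilon> > 0\<close> by simp
  finally show False
    using W(2) by simp
qed

section \<open>From local comparison with polynomials back to test functions\<close>

lemma not_P_dual_LAG_majorant:
  fixes A :: "complex^'n \<Rightarrow> complex^'n \<Rightarrow> real"
  assumes A: "A \<in> Sym2" and notP: "A \<notin> P_dual_LAG"
  obtains B t where "B \<in> Sym2" "J_invariant B" "(\<Sum>i\<in>UNIV. B (axis i 1) (axis i 1)) = 0"
    "t > 0" "\<And>v. A v v + t * (norm v)\<^sup>2 \<le> B v v"
proof -
  have bil: "bilinear A" and sym: "A v w = A w v" for v w
    using A unfolding Sym2_def by blast+
  note bsimps = bilinear_ladd[OF bil] bilinear_radd[OF bil] bilinear_lmul[OF bil]
    bilinear_rmul[OF bil] bilinear_lneg[OF bil] bilinear_rneg[OF bil]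
    linear_add[OF linear_cJ] linear_cmul[OF linear_cJ]
  \<comment> \<open>\<open>H\<close> and \<open>K\<close> are the J-invariant and J-anti-invariant
    parts of \<open>A\<close>.\<close>
  define H where "H v w = (A v w + A (cJ v) (cJ w)) / 2" for v w
  define K where "K v w = (A v w - A (cJ v) (cJ w)) / 2" for v w
  have bilH: "bilinear H" and bilK: "bilinear K"
    by (auto simp: bilinear_def H_def K_def bsimps field_simps intro!: linearI)
  have symH: "H v w = H w v" and symK: "K v w = K w v" for v w
    using sym[of v w] sym[of "cJ v" "cJ w"] by (simp_all add: H_def K_def)
  have invH: "H (cJ v) (cJ w) = H v w" and antiK: "K (cJ v) (cJ w) = - K v w" for v w
    by (simp_all add: H_def K_def bsimps field_simps)
  obtain S where S: "unitary_family S" "card S = CARD('n)"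
    and eig: "\<And>e w. e \<in> S \<Longrightarrow> e \<bullet> w = 0 \<Longrightarrow> K e w = 0" and pos: "\<And>e. e \<in> S \<Longrightarrow> 0 \<le> K e e"
    using J_anti_invariant_diagonalizable[OF bilK symK antiK] by blast
  have "trace_on (span S) A = (\<Sum>e\<in>S. A e e)"
    by (rule trace_on_eq[OF bil unitary_family_orthonormal(1)[OF S(1)]])
  then have neg: "(\<Sum>e\<in>S. A e e) < 0"
    using notP A span_unitary_family_LAG[OF S] by (force simp: P_dual_LAG_def)
  \<comment> \<open>The sum of \<open>B e e\<close> over \<open>S\<close> will be that of
    \<open>A e e\<close> plus \<open>CARD('n) * t\<close>, so this value makes \<open>B\<close>
    traceless; it is positive since \<open>A\<close> has negative trace on the Lagrangian plane
    \<open>span S\<close>.\<close>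
  define t where "t = - (\<Sum>e\<in>S. A e e) / CARD('n)"
  have "t > 0"
    using neg by (simp add: t_def divide_neg_pos)
  \<comment> \<open>The bracket is the inner product of the projections of \<open>v\<close> and
    \<open>w\<close> to the complex line of \<open>e\<close>.\<close>
  define B where "B v w = H v w + (\<Sum>e\<in>S. (K e e + t) * ((v \<bullet> e) * (w \<bullet> e) + (v \<bullet> cJ e) * (w \<bullet> cJ e)))"
    for v w
  have bilB: "bilinear B"
  proof -
    have "bilinear (\<lambda>v w. \<Sum>e\<in>S. (K e e + t) * ((v \<bullet> e) * (w \<bullet> e) + (v \<bullet> cJ e) * (w \<bullet> cJ e)))"
      unfolding bilinear_def
      by (intro allI conjI linear_compose_sum ballI linearI) (auto simp: inner_add algebra_simps)
    then show ?thesis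
      using bilH by (auto simp: bilinear_def B_def[abs_def] intro!: linear_compose_add)
  qed
  moreover have "B v w = B w v" for v w
    using symH[of v w] by (simp add: B_def mult.commute)
  ultimately have B: "B \<in> Sym2"
    unfolding Sym2_def by blast
  have invB: "J_invariant B"
    by (simp add: J_invariant_def B_def invH inner_cJ_right add.commute)
  have BS: "B e e = A e e + t" if "e \<in> S" for e
  proof -
    have "(\<Sum>f\<in>S. (K f f + t) * ((e \<bullet> f) * (e \<bullet> f) + (e \<bullet> cJ f) * (e \<bullet> cJ f)))
      = (\<Sum>f\<in>S. if f = e then K f f + t else 0)"
      using unitary_familyD[OF S(1) that] by (intro sum.cong) auto
    also have "\<dots> = K e e + t"
      using that unitary_family_finite[OF S(1)] by simp
    finally have "B e e = H e e + K e e + t"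
      by (simp add: B_def)
    then show ?thesis
      by (simp add: H_def K_def field_simps)
  qed
  have "(\<Sum>i\<in>UNIV. B (axis i 1) (axis i 1)) = (\<Sum>e\<in>S. B e e)"
    using J_invariant_trace[OF bilB invB S] by simp
  also have "\<dots> = (\<Sum>e\<in>S. A e e) + CARD('n) * t"
    using S(2) by (simp add: BS sum.distrib)
  also have "\<dots> = 0"
    by (simp add: t_def)
  finally have trB: "(\<Sum>i\<in>UNIV. B (axis i 1) (axis i 1)) = 0" .
  have "A v v + t * (norm v)\<^sup>2 \<le> B v v" for v
  proof -
    have expand: "F v = (\<Sum>e\<in>S. (v \<bullet> e) * F e + (v \<bullet> cJ e) * F (cJ e))"
      if "linear F" for F :: "complex^'n \<Rightarrow> real"
    proof -
      have "F v = F (\<Sum>e\<in>S. (v \<bullet> e) *\<^sub>R e + (v \<bullet> cJ e) *\<^sub>R cJ e)"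
        by (simp only: unitary_family_expand[OF S])
      also have "\<dots> = (\<Sum>e\<in>S. (v \<bullet> e) * F e + (v \<bullet> cJ e) * F (cJ e))"
        by (simp only: linear_sum[OF that] linear_add[OF that] linear_cmul[OF that] real_scaleR_def)
      finally show ?thesis .
    qed
    have Ke: "K e w = (e \<bullet> w) * K e e" if "e \<in> S" for e w
    proof -
      have "e \<bullet> (w - (e \<bullet> w) *\<^sub>R e) = 0"
        using unitary_familyD(1)[OF S(1) that that] by (simp add: inner_diff_right)
      from eig[OF that this] show ?thesis
        by (simp add: bilinear_rsub[OF bilK] bilinear_rmul[OF bilK])
    qed
    \<comment> \<open>Anti-invariance turns the eigenvalue \<open>K e e\<close> of \<open>e\<close>
      into its negative for \<open>cJ e\<close>.\<close>
    have KJe: "K (cJ e) w = - ((cJ e \<bullet> w) * K e e)" if "e \<in> S" for e w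
    proof -
      have "K (cJ e) w = K e (cJ w)"
        using antiK[of e "cJ w"] by (simp add: bilinear_rneg[OF bilK])
      then show ?thesis
        using Ke[OF that, of "cJ w"] by (simp add: inner_cJ_right)
    qed
    have "K v v = (\<Sum>e\<in>S. (v \<bullet> e) * K e v + (v \<bullet> cJ e) * K (cJ e) v)"
      using bilK by (intro expand[of "\<lambda>w. K w v"]) (simp add: bilinear_def)
    also have "\<dots> = (\<Sum>e\<in>S. K e e * ((v \<bullet> e)\<^sup>2 - (v \<bullet> cJ e)\<^sup>2))"
    proof (intro sum.cong refl)
      fix e assume "e \<in> S"
      have "K e v = (v \<bullet> e) * K e e" "K (cJ e) v = - ((v \<bullet> cJ e) * K e e)"
        using Ke[OF \<open>e \<in> S\<close>, of v] KJe[OF \<open>e \<in> S\<close>, of v] by (simp_all only: inner_commute[of v])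
      then show "(v \<bullet> e) * K e v + (v \<bullet> cJ e) * K (cJ e) v = K e e * ((v \<bullet> e)\<^sup>2 - (v \<bullet> cJ e)\<^sup>2)"
        by (simp add: power2_eq_square algebra_simps)
    qed
    finally have Kvv: "K v v = \<dots>" .
    have "(norm v)\<^sup>2 = (\<Sum>e\<in>S. (v \<bullet> e) * (v \<bullet> e) + (v \<bullet> cJ e) * (v \<bullet> cJ e))"
      unfolding power2_norm_eq_inner by (rule expand) (simp add: linear_iff inner_add_right)
    then have norm: "t * (norm v)\<^sup>2 = (\<Sum>e\<in>S. t * ((v \<bullet> e)\<^sup>2 + (v \<bullet> cJ e)\<^sup>2))"
      by (simp add: sum_distrib_left power2_eq_square)
    have "K v v + t * (norm v)\<^sup>2 \<le> (\<Sum>e\<in>S. (K e e + t) * ((v \<bullet> e) * (v \<bullet> e) + (v \<bullet> cJ e) * (v \<bullet> cJ e)))"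
      unfolding Kvv norm sum.distrib[symmetric]
    proof (rule sum_mono)
      fix e assume "e \<in> S"
      \<comment> \<open>The two sides of the termwise inequality differ by exactly twice this
        quantity.\<close>
      then have "0 \<le> K e e * (v \<bullet> cJ e)\<^sup>2"
        using pos by simp
      then show "K e e * ((v \<bullet> e)\<^sup>2 - (v \<bullet> cJ e)\<^sup>2) + t * ((v \<bullet> e)\<^sup>2 + (v \<bullet> cJ e)\<^sup>2)
          \<le> (K e e + t) * ((v \<bullet> e) * (v \<bullet> e) + (v \<bullet> cJ e) * (v \<bullet> cJ e))"
        by (simp add: power2_eq_square algebra_simps)
    qed
    moreover have "A v v = H v v + K v v"
      by (simp add: H_def K_def field_simps)
    ultimately show ?thesis
      by (simp add: B_def)
  qed
  then show thesis
    using that[OF B invB trB \<open>t > 0\<close>] by blast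
qed

lemma locally_sub_imp_dually_Lagrangian_psh:
  fixes X :: "(complex^'n) set"
  assumes loc: "locally_sub_traceless_hermitian X u"
  shows "dually_Lagrangian_psh X u"
  unfolding dually_Lagrangian_psh_def
proof (intro ballI allI impI, elim conjE, rule ccontr)
  fix x U \<phi>
  assume "x \<in> X" and U: "open U" "x \<in> U" and "smooth_on U \<phi>"
    and le: "\<forall>y\<in>U. u y \<le> ereal (\<phi> y)" and eq: "u x = ereal (\<phi> x)"
    and notP: "hessian_at \<phi> x \<notin> P_dual_LAG"
  have C2: "C_k_on (Suc (Suc 0)) U \<phi>"
    using \<open>smooth_on U \<phi>\<close> unfolding smooth_on_def by blast
  let ?A = "hessian_at \<phi> x" and ?D = "frechet_derivative \<phi> (at x)"
  obtain B t where B: "B \<in> Sym2" "J_invariant B" "(\<Sum>i\<in>UNIV. B (axis i 1) (axis i 1)) = 0"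
    and t: "t > 0" "\<And>v. ?A v v + t * (norm v)\<^sup>2 \<le> B v v"
    using not_P_dual_LAG_majorant[OF hessian_at_Sym2[OF U C2] notP] by blast
  have bil: "bilinear B" and sym: "B v w = B w v" for v w
    using B(1) unfolding Sym2_def by blast+
  obtain V where V: "open V" "x \<in> V" "sub_traceless_hermitian V u"
    using loc \<open>x \<in> X\<close> unfolding locally_sub_traceless_hermitian_def by blast
  obtain r\<^sub>1 where r1: "r\<^sub>1 > 0" "\<And>v. norm v \<le> r\<^sub>1 \<Longrightarrow>
      \<phi> (x + v) \<le> \<phi> x + ?D v + ?A v v / 2 + t / 4 * (norm v)\<^sup>2"
    using Taylor_second_order_le[OF U C2, of "t / 4"] t(1) by auto
  obtain r\<^sub>2 where r2: "r\<^sub>2 > 0" "cball x r\<^sub>2 \<subseteq> U \<inter> V"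
    using U V open_contains_cball[of "U \<inter> V"] by blast
  define r where "r = min r\<^sub>1 r\<^sub>2"
  have r: "r > 0" "r \<le> r\<^sub>1" "cball x r \<subseteq> U" "cball x r \<subseteq> V"
    using r1(1) r2 by (auto simp: r_def)
  define \<delta> where "\<delta> = t / 4 * r\<^sup>2"
  have "\<delta> > 0" using t(1) r(1) by (simp add: \<delta>_def)
  define h where "h z = \<phi> x - \<delta> + ?D (z - x) + B (z - x) (z - x) / 2" for z
  have D: "linear ?D"
    using C_2_onD(1)[OF C2 U(2)] has_derivative_linear by blast
  have "linear (\<lambda>z. ?D z - B x z)"
    using D bil unfolding bilinear_def by (intro linear_compose_sub) blast+
  \<comment> \<open>Recentring at the origin moves the cross terms of \<open>B\<close> into the
    linear part and leaves the quadratic part equal to \<open>B\<close>.\<close>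
  moreover have "h z = (\<phi> x - \<delta> - ?D x + B x x / 2) + (?D z - B x z) + B z z / 2" for z
    by (simp add: h_def linear_diff[OF D] bilinear_lsub[OF bil] bilinear_rsub[OF bil]
        sym[of z x] field_simps)
  ultimately have poly: "traceless_hermitian_poly h"
    unfolding traceless_hermitian_poly_iff using B by blast
  have "\<forall>z\<in>frontier (ball x r). u z \<le> ereal (h z)"
  proof
    fix z assume "z \<in> frontier (ball x r)"
    then have z: "norm (z - x) = r"
      using r(1) by (simp add: frontier_ball dist_norm norm_minus_commute)
    then have "z \<in> U"
      using r(3) by (auto simp: dist_norm norm_minus_commute)
    have "\<phi> z \<le> \<phi> x + ?D (z - x) + ?A (z - x) (z - x) / 2 + t / 4 * r\<^sup>2"
      using r1(2)[of "z - x"] z r(2) by simp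
    also have "\<dots> \<le> h z"
      using t(2)[of "z - x"] z by (simp add: h_def \<delta>_def)
    finally show "u z \<le> ereal (h z)"
      using le \<open>z \<in> U\<close> order_trans ereal_less_eq(3) by blast
  qed
  moreover have "open (ball x r)" "connected (ball x r)" "ball x r \<noteq> {}"
    "closure (ball x r) = cball x r"
    using r(1) by auto
  ultimately have "\<forall>z\<in>cball x r. u z \<le> ereal (h z)"
    using V(3) r(4) poly unfolding sub_traceless_hermitian_def
    by (metis compact_cball)
  \<comment> \<open>At the centre \<open>h x = \<phi> x - \<delta>\<close> lies strictly below
    \<open>u x\<close>.\<close>
  then have "u x \<le> ereal (h x)"
    using r(1) by (meson centre_in_cball less_imp_le)
  then have "\<phi> x \<le> h x"
    by (simp add: eq)
  then show False
    using \<open>\<delta> > 0\<close> by (simp add: h_def linear_0[OF D] bilinear_lzero[OF bil])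
qed

theorem theorem4p6:
  fixes X :: "(complex^'n) set" and u :: "complex^'n \<Rightarrow> ereal"
  assumes "open X" and "usc_on X u"
  shows "(dually_Lagrangian_psh X u \<longleftrightarrow> sub_traceless_hermitian X u) \<and>
         (sub_traceless_hermitian X u \<longleftrightarrow> locally_sub_traceless_hermitian X u)"
proof -
  \<comment> \<open>\<open>X\<close> itself serves as neighborhood of each of its points; this
    closes the cycle of implications.\<close>
  have "sub_traceless_hermitian X u \<Longrightarrow> locally_sub_traceless_hermitian X u"
    using assms(1) unfolding locally_sub_traceless_hermitian_def by blast
  then show ?thesis
    using dually_Lagrangian_psh_imp_sub[OF assms(2)] locally_sub_imp_dually_Lagrangian_psh by blast
qed

end
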